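(* Let $\Omega\subset\mathbb{R}^N$ be a bounded open set of class $C^\infty$ and let $\beta\colon\partial\Omega\to[0,\infty)$ be smooth. The operator $E_\beta\colon C(\overline\Omega)\to C_0(\mathbb{R}^N)$ is well-defined, linear, positive, contractive and an extension operator, i.e., $RE_\beta=I$, where $R\colon C_0(\mathbb{R}^N)\to C(\overline\Omega)$ is the restriction operator $u\mapsto u|_\Omega$.
   Context: $C_0(\mathbb{R}^N)$ is the space of continuous functions on $\mathbb{R}^N$ vanishing at infinity, with the sup norm; $C(\overline\Omega)$ carries the sup norm; for $u\in C_0(\mathbb{R}^N)$, $u|_\Omega$ is identified with its continuous extension to $\overline\Omega$. Well-defined includes that $E_\beta u\in C_0(\mathbb{R}^N)$ for $u\in C(\overline\Omega)$. $\nu$ is the outward pointing unit normal of $\Omega$. Construction of $E_\beta$: Fix $\delta>0$ so small that $T\colon\partial\Omega\times(-\delta,\delta)\to\mathbb{R}^N$, $T(p,t)=p+t\nu(p)$, is a smooth diffeomorphism onto a neighborhood of $\partial\Omega$ in $\mathbb{R}^N$ (this holds for all small $\delta$). Fix a function $\rho_1\in C^\infty([0,\infty)\times[0,\infty))$, $(\gamma,t)\mapsto\rho_1(\gamma,t)$, such that for all $\gamma\ge0$: $0\le\rho_1(\gamma,t)\le1$ for all $t\ge0$; $\rho_1(\gamma,t)=0$ for all $t\ge\delta/2$; $\rho_1(\gamma,0)=1$; $\partial_t\rho_1(\gamma,0)=-2\gamma$; $\partial_t^2\rho_1(\gamma,0)=4\gamma^2$. Define $\rho\colon\mathbb{R}^N\setminus\Omega\to\mathbb{R}$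 by $\rho(x)=\rho_1(\beta(z),t)$ if $x=T(z,t)$ with $z\in\partial\Omega$, $0\le t<\delta$, and $\rho(x)=0$ otherwise. For a function $u$ on $\Omega$ let $\tilde u$ be the reflected function on $T(\partial\Omega\times(0,\delta))$, $\tilde u(T(z,t)):=u(T(z,-t))$. For $u\in C(\overline\Omega)$ put $E_\beta u:=u$ on $\overline\Omega$ and $E_\beta u:=\rho\tilde u$ on $\mathbb{R}^N\setminus\overline\Omega$, where $\rho\tilde u$ is understood to be $0$ outside $T(\partial\Omega\times(0,\delta))$. *)

theory Defs
  imports "HOL-Analysis.Analysis" "HOL-Library.FuncSet"
begin

primrec Ck_on :: "nat \<Rightarrow> 'a::real_normed_vector set \<Rightarrow> ('a \<Rightarrow> 'b::real_normed_vector) \<Rightarrow> bool" where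
  "Ck_on 0 U f \<longleftrightarrow> continuous_on U f"
| "Ck_on (Suc k) U f \<longleftrightarrow>
     (\<forall>x\<in>U. f differentiable (at x)) \<and> (\<forall>v. Ck_on k U (\<lambda>x. frechet_derivative f (at x) v))"

text \<open>Smoothness on an arbitrary set: near each of its points the function agrees with a
  \<open>C\<^sup>\<infinity>\<close> function defined on an open set. On open sets this is the usual notion; on an embedded
  submanifold (such as the boundary of a smooth domain) it is smoothness in charts; on
  \<open>[0,\<infinity>) \<times> [0,\<infinity>)\<close> it is smoothness up to the boundary.\<close>

definition smooth_on :: "'a::real_normed_vector set \<Rightarrow> ('a \<Rightarrow> 'b::real_normed_vector) \<Rightarrow> bool" where
  "smooth_on S f \<longleftrightarrow>
     (\<forall>x\<in>S. \<exists>U g. open U \<and> x \<in> U \<and> (\<forall>k. Ck_on k U g) \<and> (\<forall>y\<in>S \<inter> U. g y = f y))"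

definition smooth_diffeomorphism ::
  "'a::real_normed_vector set \<Rightarrow> 'b::real_normed_vector set \<Rightarrow> ('a \<Rightarrow> 'b) \<Rightarrow> bool" where
  "smooth_diffeomorphism A B f \<longleftrightarrow>
     bij_betw f A B \<and> smooth_on A f \<and> smooth_on B (inv_into A f)"

text \<open>The set lies locally strictly above the graph of a smooth function, after reorienting the
  axes: the unit vector \<open>e\<close> is the vertical direction and \<open>x - (x \<bullet> e) *\<^sub>R e\<close> is the horizontal
  part of \<open>x\<close>, so only the values of \<open>h\<close> on the hyperplane orthogonal to \<open>e\<close> matter.\<close>

definition smooth_boundary :: "'a::euclidean_space set \<Rightarrow> bool" where
  "smooth_boundary \<Omega> \<longleftrightarrow>
     (\<forall>p\<in>frontier \<Omega>. \<exists>r>0. \<exists>e h. norm e = 1 \<and> smooth_on UNIV h \<and>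
        \<Omega> \<inter> ball p r = {x \<in> ball p r. x \<bullet> e > (h (x - (x \<bullet> e) *\<^sub>R e) :: real)})"

definition tangent_space :: "'a::euclidean_space set \<Rightarrow> 'a \<Rightarrow> 'a set" where
  "tangent_space M p =
     {v. \<exists>\<epsilon>>0. \<exists>c :: real \<Rightarrow> 'a. smooth_on {-\<epsilon><..<\<epsilon>} c \<and> c ` {-\<epsilon><..<\<epsilon>} \<subseteq> M \<and>
           c 0 = p \<and> (c has_vector_derivative v) (at 0)}"

definition outward_unit_normal :: "'a::euclidean_space set \<Rightarrow> 'a \<Rightarrow> 'a \<Rightarrow> bool" where
  "outward_unit_normal \<Omega> p n \<longleftrightarrow>
     norm n = 1 \<and> (\<forall>v\<in>tangent_space (frontier \<Omega>) p. n \<bullet> v = 0) \<and>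
     (\<exists>\<epsilon>>0. \<forall>t\<in>{0<..<\<epsilon>}. p + t *\<^sub>R n \<notin> closure \<Omega> \<and> p - t *\<^sub>R n \<in> \<Omega>)"

text \<open>Functions on a subset \<open>K\<close> are represented by their extensional representatives, so that
  equality in \<open>C_on K\<close> is equality of functions on \<open>K\<close>.\<close>

definition C_on :: "'a::topological_space set \<Rightarrow> ('a \<Rightarrow> real) set" where
  "C_on K = {u \<in> extensional K. continuous_on K u}"

definition C0 :: "('a::real_normed_vector \<Rightarrow> real) set" where
  "C0 = {u. continuous_on UNIV u \<and> (u \<longlongrightarrow> 0) at_infinity}"

text \<open>The case distinction is needed because \<open>Sup {}\<close> is unspecified for type \<^typ>\<open>real\<close>.\<close>

definition sup_norm :: "'a set \<Rightarrow> ('a \<Rightarrow> real) \<Rightarrow> real" where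
  "sup_norm K u = (if K = {} then 0 else SUP x\<in>K. \<bar>u x\<bar>)"

definition restriction_op :: "'a::topological_space set \<Rightarrow> ('a \<Rightarrow> real) \<Rightarrow> 'a \<Rightarrow> real" where
  "restriction_op \<Omega> u = restrict u (closure \<Omega>)"

text \<open>This is the unique continuous extension to \<open>closure \<Omega>\<close> of the restriction to \<open>\<Omega>\<close>.\<close>

lemma restriction_op_unique_extension:
  assumes "u \<in> C0"
  shows "v = restriction_op \<Omega> u \<longleftrightarrow> v \<in> C_on (closure \<Omega>) \<and> (\<forall>x\<in>\<Omega>. v x = u x)"
proof
  have u: "continuous_on (closure \<Omega>) u"
    using assms by (auto simp: C0_def intro: continuous_on_subset)
  {
    assume "v = restriction_op \<Omega> u"
    with u show "v \<in> C_on (closure \<Omega>) \<and> (\<forall>x\<in>\<Omega>. v x = u x)"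
      using closure_subset[of \<Omega>]
      by (auto simp: C_on_def restriction_op_def cong: continuous_on_cong)
  next
    assume v: "v \<in> C_on (closure \<Omega>) \<and> (\<forall>x\<in>\<Omega>. v x = u x)"
    have "continuous_on (closure \<Omega>) (\<lambda>x. v x - u x)"
      using u v by (auto simp: C_on_def intro: continuous_on_diff)
    then have "v x - u x = 0" if "x \<in> closure \<Omega>" for x
      by (rule continuous_constant_on_closure) (use v that in auto)
    then show "v = restriction_op \<Omega> u"
      using v by (auto simp: C_on_def restriction_op_def extensional_def fun_eq_iff)
  }
qed

definition normal_map :: "('a::euclidean_space \<Rightarrow> 'a) \<Rightarrow> 'a \<times> real \<Rightarrow> 'a" where
  "normal_map \<nu> = (\<lambda>(p, t). p + t *\<^sub>R \<nu> p)"

text \<open>The partial derivative in the second variable, one-sided at \<open>0\<close>.\<close>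

definition partial_t :: "(real \<times> real \<Rightarrow> real) \<Rightarrow> real \<Rightarrow> real \<Rightarrow> real" where
  "partial_t \<rho>1 \<gamma> t = vector_derivative (\<lambda>s. \<rho>1 (\<gamma>, s)) (at t within {0..})"

text \<open>The choice made by \<^const>\<open>inv_into\<close> is immaterial in the two definitions below, as
  \<open>normal_map \<nu>\<close> is injective on \<open>frontier \<Omega> \<times> {-\<delta><..<\<delta>}\<close> for the values of \<open>\<delta>\<close> considered.\<close>

definition cutoff ::
  "'a::euclidean_space set \<Rightarrow> ('a \<Rightarrow> 'a) \<Rightarrow> real \<Rightarrow> (real \<times> real \<Rightarrow> real) \<Rightarrow> ('a \<Rightarrow> real) \<Rightarrow> 'a \<Rightarrow> real" where
  "cutoff \<Omega> \<nu> \<delta> \<rho>1 \<beta> x =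
     (if x \<in> normal_map \<nu> ` (frontier \<Omega> \<times> {0..<\<delta>})
      then (case inv_into (frontier \<Omega> \<times> {0..<\<delta>}) (normal_map \<nu>) x of (z, t) \<Rightarrow> \<rho>1 (\<beta> z, t))
      else 0)"

definition reflected ::
  "'a::euclidean_space set \<Rightarrow> ('a \<Rightarrow> 'a) \<Rightarrow> real \<Rightarrow> ('a \<Rightarrow> real) \<Rightarrow> 'a \<Rightarrow> real" where
  "reflected \<Omega> \<nu> \<delta> u x =
     (case inv_into (frontier \<Omega> \<times> {0<..<\<delta>}) (normal_map \<nu>) x of
        (z, t) \<Rightarrow> u (normal_map \<nu> (z, - t)))"

definition extension_op ::
  "'a::euclidean_space set \<Rightarrow> ('a \<Rightarrow> 'a) \<Rightarrow> real \<Rightarrow> (real \<times> real \<Rightarrow> real) \<Rightarrow> ('a \<Rightarrow> real)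
     \<Rightarrow> ('a \<Rightarrow> real) \<Rightarrow> 'a \<Rightarrow> real" where
  "extension_op \<Omega> \<nu> \<delta> \<rho>1 \<beta> u x =
     (if x \<in> closure \<Omega> then u x
      else if x \<in> normal_map \<nu> ` (frontier \<Omega> \<times> {0<..<\<delta>})
      then cutoff \<Omega> \<nu> \<delta> \<rho>1 \<beta> x * reflected \<Omega> \<nu> \<delta> u x
      else 0)"

end

theory Submission
  imports Defs
begin

text \<open>
  Write \<open>F\<close> for the boundary of \<open>\<Omega>\<close> and \<open>T (z, t) = z + t \<nu>(z)\<close>. Since \<open>T\<close> is injective on
  \<open>F \<times> (-\<delta>, \<delta>)\<close> and \<open>T (p, 0) = p\<close>, a normal segment \<open>{T (z, t) | 0 < t < \<delta>}\<close> or
  \<open>{T (z, -t) | 0 < t < \<delta>}\<close> never meets \<open>F\<close>. It is connected, so it stays on the side of \<open>F\<close> on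
  which it starts: the outer segments avoid \<open>closure \<Omega>\<close>, and the inner ones lie in \<open>\<Omega>\<close>
  (lemmas \<open>outer_normal_notin\<close> and \<open>inner_normal_in\<close>). Hence the reflected function is defined, and
  \<open>E u (T (z, t)) = \<rho>1 (\<beta> z, t) * u (T (z, -t))\<close> for \<open>0 \<le> t < \<delta>\<close>, where the case \<open>t = 0\<close> uses
  \<open>\<rho>1 (\<beta> z, 0) = 1\<close>; outside \<open>closure \<Omega>\<close> and the collar, \<open>E u\<close> vanishes. Linearity, positivity,
  contractivity and the extension property can be read off from these formulas and
  \<open>0 \<le> \<rho>1 \<le> 1\<close>.

  What remains is \<open>E u \<in> C0\<close>. The complement of \<open>\<Omega>\<close> is the union of two relatively open
  parts, \<open>T (F \<times> [0, \<delta>)) = V - \<Omega>\<close> and \<open>- \<Omega> - T (F \<times> [0, \<delta>/2])\<close>; the latter is relatively open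
  because \<open>F\<close>, and hence \<open>T (F \<times> [0, \<delta>/2])\<close>, is compact. On the
  first, \<open>E u\<close> is continuous because the inverse of \<open>T\<close> is; on the second it is \<open>0\<close>, as \<open>\<rho>1\<close>
  vanishes for \<open>t \<ge> \<delta>/2\<close>. Gluing along the closed sets \<open>closure \<Omega>\<close> and \<open>- \<Omega>\<close> gives continuity on
  the whole space (lemma \<open>continuous_extension\<close>), and \<open>E u\<close> is supported in the bounded set
  \<open>closure \<Omega> \<union> T (F \<times> [0, \<delta>/2])\<close>.
\<close>

section \<open>Continuity, connectedness and the sup norm\<close>

lemma smooth_on_imp_continuous_on:
  assumes "smooth_on S f"
  shows "continuous_on S f"
  unfolding continuous_on_eq_continuous_within
proof
  fix x assume x: "x \<in> S"
  then obtain U g where U: "open U" "x \<in> U" and g: "\<forall>k. Ck_on k U g" "\<forall>y\<in>S \<inter> U. g y = f y"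
    using assms unfolding smooth_on_def by blast
  have "continuous_on U g"
    using g(1)[rule_format, of 0] by simp
  then have "continuous_on (S \<inter> U) f"
    using g(2) by (metis continuous_on_cong continuous_on_subset inf_le2)
  then have "continuous (at x within S \<inter> U) f"
    using U x by (simp add: continuous_on_eq_continuous_within)
  moreover have "at x within S \<inter> U = at x within S"
    using U by (intro at_within_nhd[of x U]) auto
  ultimately show "continuous (at x within S) f" by simp
qed

lemma connected_disjoint_frontier:
  assumes "connected C" "C \<inter> frontier \<Omega> = {}" "C \<inter> \<Omega> \<noteq> {}"
  shows "C \<subseteq> \<Omega>"
  using connected_Int_frontier[of C \<Omega>] assms by blast

lemma compact_imp_abs_le_sup_norm:
  assumes "compact K" "continuous_on K u" "x \<in> K"
  shows "\<bar>u x\<bar> \<le> sup_norm K u"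
proof -
  have "compact ((\<lambda>x. \<bar>u x\<bar>) ` K)"
    using assms by (intro compact_continuous_image continuous_intros)
  then have "bdd_above ((\<lambda>x. \<bar>u x\<bar>) ` K)"
    by (intro bounded_imp_bdd_above compact_imp_bounded)
  with assms(3) show ?thesis
    by (auto simp: sup_norm_def intro: cSUP_upper2)
qed

section \<open>Normal segments in the collar\<close>

text \<open>
  A bounded open set with a collar of width \<open>\<delta>\<close> along a field \<open>\<nu>\<close> that points outwards: the map
  \<open>(p, t) \<mapsto> p + t \<nu>(p)\<close> is a homeomorphism onto an open set.
\<close>

locale outward_collar =
  fixes \<Omega> :: "'a::euclidean_space set" and \<nu> :: "'a \<Rightarrow> 'a" and \<delta> :: real and V :: "'a set"
  assumes bounded: "bounded \<Omega>"
    and open_domain: "open \<Omega>"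
    and outward: "p \<in> frontier \<Omega> \<Longrightarrow>
          \<exists>\<epsilon>>0. \<forall>t\<in>{0<..<\<epsilon>}. p + t *\<^sub>R \<nu> p \<notin> closure \<Omega> \<and> p - t *\<^sub>R \<nu> p \<in> \<Omega>"
    and width_pos: "0 < \<delta>"
    and open_collar: "open V"
    and bij: "bij_betw (normal_map \<nu>) (frontier \<Omega> \<times> {-\<delta><..<\<delta>}) V"
    and continuous_map: "continuous_on (frontier \<Omega> \<times> {-\<delta><..<\<delta>}) (normal_map \<nu>)"
    and continuous_inv: "continuous_on V (inv_into (frontier \<Omega> \<times> {-\<delta><..<\<delta>}) (normal_map \<nu>))"
begin

abbreviation "F \<equiv> frontier \<Omega>"
abbreviation "T \<equiv> normal_map \<nu>"

lemma inj: "inj_on T (F \<times> {-\<delta><..<\<delta>})"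
  using bij by (rule bij_betw_imp_inj_on)

lemma normal_map_zero [simp]: "T (p, 0) = p"
  by (simp add: normal_map_def)

lemma normal_map_notin_frontier:
  assumes "z \<in> F" "\<bar>t\<bar> < \<delta>" "t \<noteq> 0"
  shows "T (z, t) \<notin> F"
proof
  assume "T (z, t) \<in> F"
  then have "(z, t) = (T (z, t), 0)"
    using assms width_pos by (intro inj_onD[OF inj]) auto
  with assms(3) show False by simp
qed

lemma connected_normal_segment: "connected ((\<lambda>s. T (z, c * s)) ` {0<..<\<delta>})"
  unfolding normal_map_def
  by (intro connected_continuous_image) (auto intro!: continuous_intros)

lemma inner_normal_in:
  assumes z: "z \<in> F" and t: "0 < t" "t < \<delta>"
  shows "T (z, - t) \<in> \<Omega>"
proof -
  obtain \<epsilon> where \<epsilon>: "\<epsilon> > 0" "\<And>t. 0 < t \<Longrightarrow> t < \<epsilon> \<Longrightarrow> z - t *\<^sub>R \<nu> z \<in> \<Omega>"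
    using outward[OF z] by auto
  let ?C = "(\<lambda>s. T (z, (-1) * s)) ` {0<..<\<delta>}"
  have "?C \<subseteq> \<Omega>"
  proof (rule connected_disjoint_frontier)
    show "connected ?C" by (rule connected_normal_segment)
    show "?C \<inter> F = {}"
      using normal_map_notin_frontier[OF z] by auto
    obtain s where s: "0 < s" "s < \<epsilon>" "s < \<delta>"
      using \<epsilon>(1) width_pos field_lbound_gt_zero by blast
    then have "T (z, (-1) * s) \<in> \<Omega>"
      using \<epsilon>(2) by (simp add: normal_map_def)
    moreover have "s \<in> {0<..<\<delta>}"
      using s by simp
    ultimately show "?C \<inter> \<Omega> \<noteq> {}" by blast
  qed
  with t show ?thesis by auto
qed

lemma outer_normal_notin:
  assumes z: "z \<in> F" and t: "0 < t" "t < \<delta>"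
  shows "T (z, t) \<notin> closure \<Omega>"
proof -
  obtain \<epsilon> where \<epsilon>: "\<epsilon> > 0" "\<And>t. 0 < t \<Longrightarrow> t < \<epsilon> \<Longrightarrow> z + t *\<^sub>R \<nu> z \<notin> closure \<Omega>"
    using outward[OF z] by auto
  let ?C = "(\<lambda>s. T (z, 1 * s)) ` {0<..<\<delta>}"
  have avoid: "?C \<inter> F = {}"
    using normal_map_notin_frontier[OF z] by auto
  have "?C \<subseteq> - \<Omega>"
  proof (rule connected_disjoint_frontier)
    show "connected ?C" by (rule connected_normal_segment)
    show "?C \<inter> frontier (- \<Omega>) = {}"
      using avoid by (simp add: frontier_complement)
    obtain s where s: "0 < s" "s < \<epsilon>" "s < \<delta>"
      using \<epsilon>(1) width_pos field_lbound_gt_zero by blast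
    then have "T (z, 1 * s) \<notin> \<Omega>"
      using \<epsilon>(2)[of s] closure_subset[of \<Omega>] by (auto simp: normal_map_def)
    moreover have "s \<in> {0<..<\<delta>}"
      using s by simp
    ultimately show "?C \<inter> - \<Omega> \<noteq> {}" by blast
  qed
  moreover have "T (z, t) \<in> ?C"
    using t by auto
  ultimately show ?thesis
    using avoid by (auto simp: closure_Un_frontier)
qed

lemma reflected_in_closure:
  assumes "z \<in> F" "0 \<le> t" "t < \<delta>"
  shows "T (z, - t) \<in> closure \<Omega>"
proof (cases "t = 0")
  case True
  then show ?thesis using assms(1) by (simp add: frontier_def)
next
  case False
  then show ?thesis
    using assms inner_normal_in[of z t] closure_subset by fastforce
qed

lemma outer_collar_eq: "T ` (F \<times> {0..<\<delta>}) = V - \<Omega>"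
proof
  show "T ` (F \<times> {0..<\<delta>}) \<subseteq> V - \<Omega>"
  proof clarify
    fix z t assume z: "z \<in> F" and t: "t \<in> {0..<\<delta>}"
    have "T (z, t) \<in> V"
      using z t width_pos by (intro bij_betwE[OF bij, rule_format]) auto
    moreover have "T (z, t) \<notin> \<Omega>"
      using z t outer_normal_notin[of z t] closure_subset[of \<Omega>] open_domain
      by (cases "t = 0") (auto simp: frontier_def interior_open)
    ultimately show "T (z, t) \<in> V - \<Omega>" by simp
  qed
  show "V - \<Omega> \<subseteq> T ` (F \<times> {0..<\<delta>})"
  proof
    fix x assume x: "x \<in> V - \<Omega>"
    then obtain z t where zt: "z \<in> F" "t \<in> {-\<delta><..<\<delta>}" "x = T (z, t)"
      using bij_betw_imp_surj_on[OF bij] by blast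
    have "0 \<le> t"
      using inner_normal_in[of z "- t"] zt x by force
    with zt show "x \<in> T ` (F \<times> {0..<\<delta>})" by auto
  qed
qed

lemma inv_into_normal_map:
  assumes "z \<in> F" "t \<in> I" "I \<subseteq> {-\<delta><..<\<delta>}"
  shows "inv_into (F \<times> I) T (T (z, t)) = (z, t)"
  using assms by (intro inv_into_f_f inj_on_subset[OF inj]) auto

lemma compact_inner_collar: "compact (T ` (F \<times> {0..\<delta>/2}))"
  using width_pos
  by (intro compact_continuous_image continuous_on_subset[OF continuous_map] compact_Times
      compact_frontier_bounded bounded) auto

end

section \<open>The extension operator\<close>

text \<open>
  The extension operator over such a collar, with a weight \<open>\<rho>1 (\<beta> z, t)\<close> that is only required to be
  continuous, to take values in \<open>[0, 1]\<close>, to be \<open>1\<close> on the boundary and to vanish for \<open>t \<ge> \<delta>/2\<close>.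
\<close>

locale collar_extension = outward_collar \<Omega> \<nu> \<delta> V
  for \<Omega> :: "'a::euclidean_space set" and \<nu> :: "'a \<Rightarrow> 'a" and \<delta> :: real and V :: "'a set" +
  fixes \<beta> :: "'a \<Rightarrow> real" and \<rho>1 :: "real \<times> real \<Rightarrow> real"
  assumes continuous_beta: "continuous_on (frontier \<Omega>) \<beta>"
    and beta_nonneg: "z \<in> frontier \<Omega> \<Longrightarrow> 0 \<le> \<beta> z"
    and continuous_rho: "continuous_on ({0..} \<times> {0..}) \<rho>1"
    and rho_bounds: "0 \<le> \<gamma> \<Longrightarrow> 0 \<le> t \<Longrightarrow> 0 \<le> \<rho>1 (\<gamma>, t) \<and> \<rho>1 (\<gamma>, t) \<le> 1"
    and rho_eq_0: "0 \<le> \<gamma> \<Longrightarrow> \<delta>/2 \<le> t \<Longrightarrow> \<rho>1 (\<gamma>, t) = 0"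
    and rho_eq_1: "0 \<le> \<gamma> \<Longrightarrow> \<rho>1 (\<gamma>, 0) = 1"
begin

abbreviation "E \<equiv> extension_op \<Omega> \<nu> \<delta> \<rho>1 \<beta>"

lemma extension_closure: "x \<in> closure \<Omega> \<Longrightarrow> E u x = u x"
  by (simp add: extension_op_def)

lemma extension_collar:
  assumes z: "z \<in> F" and t: "0 \<le> t" "t < \<delta>"
  shows "E u (T (z, t)) = \<rho>1 (\<beta> z, t) * u (T (z, - t))"
proof (cases "t = 0")
  case True
  have "z \<in> closure \<Omega>"
    using z by (simp add: frontier_def)
  then show ?thesis
    using True z by (simp add: extension_closure rho_eq_1 beta_nonneg)
next
  case False
  with t have t': "0 < t" by simp
  have "inv_into (F \<times> {0..<\<delta>}) T (T (z, t)) = (z, t)"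
    using z t width_pos by (intro inv_into_normal_map) auto
  moreover have "T (z, t) \<in> T ` (F \<times> {0..<\<delta>})"
    using z t by auto
  ultimately have "cutoff \<Omega> \<nu> \<delta> \<rho>1 \<beta> (T (z, t)) = \<rho>1 (\<beta> z, t)"
    by (simp add: cutoff_def)
  moreover have "inv_into (F \<times> {0<..<\<delta>}) T (T (z, t)) = (z, t)"
    using z t t' width_pos by (intro inv_into_normal_map) auto
  then have "reflected \<Omega> \<nu> \<delta> u (T (z, t)) = u (T (z, - t))"
    by (simp add: reflected_def)
  moreover have "T (z, t) \<in> T ` (F \<times> {0<..<\<delta>})"
    using z t t' by auto
  ultimately show ?thesis
    using outer_normal_notin[OF z t' t(2)] by (simp add: extension_op_def)
qed

lemma extension_outside:
  assumes "x \<notin> closure \<Omega>" "x \<notin> T ` (F \<times> {0<..<\<delta>})"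
  shows "E u x = 0"
  using assms by (auto simp: extension_op_def)

text \<open>
  At each point \<open>x\<close> one of the three formulas for \<open>E u x\<close> holds for all \<open>u\<close> at once, so that they
  can also be compared for different functions. The cases overlap on the boundary.
\<close>

lemma extension_cases [case_names closure collar outside]:
  obtains "x \<in> closure \<Omega>" "\<And>u. E u x = u x"
  | z t where "z \<in> F" "0 \<le> t" "t < \<delta>" "x = T (z, t)" "T (z, - t) \<in> closure \<Omega>"
      "\<And>u. E u x = \<rho>1 (\<beta> z, t) * u (T (z, - t))"
  | "\<And>u. E u x = 0"
proof -
  consider "x \<in> closure \<Omega>" | "x \<in> T ` (F \<times> {0<..<\<delta>})"
    | "x \<notin> closure \<Omega>" "x \<notin> T ` (F \<times> {0<..<\<delta>})" by blast
  then show thesis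
  proof cases
    case 1
    then show thesis by (rule that(1)) (simp add: extension_closure 1)
  next
    case 2
    then obtain z t where zt: "z \<in> F" "0 < t" "t < \<delta>" "x = T (z, t)" by auto
    show thesis
      by (rule that(2)[of z t]) (use zt extension_collar reflected_in_closure in auto)
  next
    case 3
    then show thesis by (intro that(3) extension_outside)
  qed
qed

lemma extension_eq_0:
  assumes "x \<notin> \<Omega>" "x \<notin> T ` (F \<times> {0..\<delta>/2})"
  shows "E u x = 0"
proof (cases x rule: extension_cases)
  case closure
  then have "x \<in> F"
    using assms(1) open_domain by (simp add: frontier_def interior_open)
  then have "T (x, 0) \<in> T ` (F \<times> {0..\<delta>/2})"
    using width_pos by (intro imageI) auto
  with assms(2) show ?thesis by simp
next
  case (collar z t)
  then have "\<delta>/2 \<le> t"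
    using assms(2) by force
  then show ?thesis
    using collar by (simp add: rho_eq_0 beta_nonneg)
qed simp

text \<open>
  On the outer collar, including the boundary (\<open>t = 0\<close>), \<open>E u\<close> is the composition of the continuous inverse of \<open>T\<close> with the
  function \<open>(z, t) \<mapsto> \<rho>1 (\<beta> z, t) * u (T (z, -t))\<close>.
\<close>

lemma continuous_extension_collar:
  assumes u: "continuous_on (closure \<Omega>) u"
  shows "continuous_on (T ` (F \<times> {0..<\<delta>})) (E u)"
proof -
  define S where "S = inv_into (F \<times> {-\<delta><..<\<delta>}) T"
  define g where "g = (\<lambda>(z, t). \<rho>1 (\<beta> z, t) * u (T (z, - t)))"
  have S: "S (T (z, t)) = (z, t)" if "z \<in> F" "0 \<le> t" "t < \<delta>" for z t
    unfolding S_def using that width_pos by (intro inv_into_normal_map) auto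
  have rho: "continuous_on (F \<times> {0..<\<delta>}) (\<lambda>p. \<rho>1 (\<beta> (fst p), snd p))"
    by (rule continuous_on_compose2[OF continuous_rho])
      (auto intro!: continuous_intros continuous_on_compose2[OF continuous_beta] beta_nonneg)
  have "continuous_on (F \<times> {0..<\<delta>}) (\<lambda>p. T (fst p, - snd p))"
    by (rule continuous_on_compose2[OF continuous_map])
      (use width_pos in \<open>auto intro!: continuous_intros\<close>)
  then have "continuous_on (F \<times> {0..<\<delta>}) (\<lambda>p. u (T (fst p, - snd p)))"
    by (rule continuous_on_compose2[OF u]) (auto intro: reflected_in_closure)
  with rho have g: "continuous_on (F \<times> {0..<\<delta>}) g"
    unfolding g_def case_prod_beta by (rule continuous_on_mult)
  have "continuous_on (T ` (F \<times> {0..<\<delta>})) S"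
    unfolding S_def by (rule continuous_on_subset[OF continuous_inv]) (auto simp: outer_collar_eq)
  then have "continuous_on (T ` (F \<times> {0..<\<delta>})) (\<lambda>x. g (S x))"
    by (rule continuous_on_compose2[OF g]) (auto simp: S)
  moreover have "g (S x) = E u x" if "x \<in> T ` (F \<times> {0..<\<delta>})" for x
    using that by (auto simp: S g_def extension_collar)
  ultimately show ?thesis
    by (simp cong: continuous_on_cong)
qed

lemma continuous_extension:
  assumes u: "continuous_on (closure \<Omega>) u"
  shows "continuous_on UNIV (E u)"
proof -
  let ?A = "T ` (F \<times> {0..<\<delta>})" and ?B = "- \<Omega> - T ` (F \<times> {0..\<delta>/2})"
  have "T ` (F \<times> {0..\<delta>/2}) \<subseteq> ?A"
    using width_pos by (intro image_mono) auto
  then have cover: "?A \<union> ?B = - \<Omega>"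
    using outer_collar_eq by blast
  have "continuous_on (?A \<union> ?B) (E u)"
  proof (rule continuous_on_Un_local_open)
    have "?A = - \<Omega> \<inter> V"
      using outer_collar_eq by blast
    then show "openin (top_of_set (?A \<union> ?B)) ?A"
      unfolding cover using open_collar by (simp add: openin_open_Int)
    have "?B = - \<Omega> \<inter> - T ` (F \<times> {0..\<delta>/2})" by blast
    then show "openin (top_of_set (?A \<union> ?B)) ?B"
      unfolding cover using compact_imp_closed[OF compact_inner_collar]
      by (metis openin_open_Int open_Compl)
    show "continuous_on ?A (E u)"
      using u by (rule continuous_extension_collar)
    have "continuous_on ?B (\<lambda>_. 0 :: real)" by simp
    then show "continuous_on ?B (E u)"
      by (rule continuous_on_eq) (simp add: extension_eq_0)
  qed
  then have "continuous_on (- \<Omega>) (E u)"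
    by (simp only: cover)
  moreover have "continuous_on (closure \<Omega>) (E u)"
    using u by (rule continuous_on_eq) (simp add: extension_closure)
  ultimately have "continuous_on (closure \<Omega> \<union> - \<Omega>) (E u)"
    using open_domain by (intro continuous_on_closed_Un) auto
  moreover have "closure \<Omega> \<union> - \<Omega> = UNIV"
    using closure_subset by blast
  ultimately show ?thesis by simp
qed

lemma extension_tendsto_0: "(E u \<longlongrightarrow> 0) at_infinity"
proof -
  have "bounded (\<Omega> \<union> T ` (F \<times> {0..\<delta>/2}))"
    using bounded compact_imp_bounded[OF compact_inner_collar] by simp
  then obtain b where b: "\<And>x. x \<in> \<Omega> \<union> T ` (F \<times> {0..\<delta>/2}) \<Longrightarrow> norm x \<le> b"
    unfolding bounded_iff by blast
  have "E u x = 0" if "b + 1 \<le> norm x" for x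
    using b[of x] that by (intro extension_eq_0) auto
  then have "eventually (\<lambda>x. E u x = 0) at_infinity"
    unfolding eventually_at_infinity by blast
  then show ?thesis
    by (rule tendsto_eventually)
qed

lemma extension_in_C0:
  assumes "u \<in> C_on (closure \<Omega>)"
  shows "E u \<in> C0"
  using assms by (simp add: C_on_def C0_def continuous_extension extension_tendsto_0)

lemma extension_linear:
  "E (\<lambda>x\<in>closure \<Omega>. a * u x + b * v x) = (\<lambda>x. a * E u x + b * E v x)"
proof
  fix x
  show "E (\<lambda>x\<in>closure \<Omega>. a * u x + b * v x) x = a * E u x + b * E v x"
    by (cases x rule: extension_cases) (simp_all add: algebra_simps)
qed

lemma extension_nonneg:
  assumes "\<forall>x\<in>closure \<Omega>. 0 \<le> u x"
  shows "0 \<le> E u x"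
  using assms
  by (cases x rule: extension_cases) (auto intro!: mult_nonneg_nonneg simp: rho_bounds beta_nonneg)

lemma extension_contractive:
  assumes u: "continuous_on (closure \<Omega>) u"
  shows "sup_norm UNIV (E u) \<le> sup_norm (closure \<Omega>) u"
proof -
  have cpt: "compact (closure \<Omega>)"
    using bounded by (simp add: compact_closure)
  note le = compact_imp_abs_le_sup_norm[OF cpt u]
  \<comment> \<open>If \<open>\<Omega>\<close> is empty, the norm on the right is \<open>0\<close> by convention.\<close>
  have nonneg: "0 \<le> sup_norm (closure \<Omega>) u"
  proof (cases "closure \<Omega> = {}")
    case False
    then obtain y where "y \<in> closure \<Omega>" by (meson all_not_in_conv)
    from le[OF this] show ?thesis by linarith
  qed (simp add: sup_norm_def)
  have "\<bar>E u x\<bar> \<le> sup_norm (closure \<Omega>) u" for x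
  proof (cases x rule: extension_cases)
    case closure
    then show ?thesis using le by simp
  next
    case (collar z t)
    have "\<rho>1 (\<beta> z, t) * \<bar>u (T (z, - t))\<bar> \<le> 1 * \<bar>u (T (z, - t))\<bar>"
      using collar rho_bounds beta_nonneg by (intro mult_right_mono) auto
    also have "\<dots> \<le> sup_norm (closure \<Omega>) u"
      using le[OF collar(5)] by simp
    finally show ?thesis
      using collar rho_bounds[of "\<beta> z" t] beta_nonneg by (simp add: abs_mult)
  next
    case outside
    then show ?thesis using nonneg by simp
  qed
  then show ?thesis
    unfolding sup_norm_def[of UNIV] by (auto intro: cSUP_least)
qed

lemma restriction_extension:
  assumes "u \<in> C_on (closure \<Omega>)"
  shows "restriction_op \<Omega> (E u) = u"
  using assms
  by (auto simp: restriction_op_def C_on_def extension_closure fun_eq_iff extensional_def)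

end

theorem lemma5:
  fixes \<Omega> :: "(real ^ 'n) set"
    and \<beta> :: "real ^ 'n \<Rightarrow> real"
    and \<nu> :: "real ^ 'n \<Rightarrow> real ^ 'n"
    and \<delta> :: real
    and \<rho>1 :: "real \<times> real \<Rightarrow> real"
  defines "E \<equiv> extension_op \<Omega> \<nu> \<delta> \<rho>1 \<beta>"
  assumes "bounded \<Omega>" and "open \<Omega>" and "smooth_boundary \<Omega>"
    and "smooth_on (frontier \<Omega>) \<beta>" and "\<forall>z\<in>frontier \<Omega>. 0 \<le> \<beta> z"
    and "\<forall>p\<in>frontier \<Omega>. outward_unit_normal \<Omega> p (\<nu> p)"
    and "0 < \<delta>"
    and "\<exists>V. open V \<and> frontier \<Omega> \<subseteq> V \<and>
           smooth_diffeomorphism (frontier \<Omega> \<times> {-\<delta><..<\<delta>}) V (normal_map \<nu>)"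
    and "smooth_on ({0..} \<times> {0..}) \<rho>1"
    and "\<forall>\<gamma>\<ge>0. \<forall>t\<ge>0. 0 \<le> \<rho>1 (\<gamma>, t) \<and> \<rho>1 (\<gamma>, t) \<le> 1"
    and "\<forall>\<gamma>\<ge>0. \<forall>t\<ge>\<delta>/2. \<rho>1 (\<gamma>, t) = 0"
    and "\<forall>\<gamma>\<ge>0. \<rho>1 (\<gamma>, 0) = 1"
    and "\<forall>\<gamma>\<ge>0. partial_t \<rho>1 \<gamma> 0 = - 2 * \<gamma>"
    and "\<forall>\<gamma>\<ge>0. (partial_t \<rho>1 \<gamma> has_real_derivative 4 * \<gamma>\<^sup>2) (at 0 within {0..})"
  shows
    "(\<forall>z\<in>frontier \<Omega>. \<forall>t\<in>{0<..<\<delta>}. normal_map \<nu> (z, - t) \<in> \<Omega>) \<and>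
     E \<in> C_on (closure \<Omega>) \<rightarrow> C0 \<and>
     (\<forall>u\<in>C_on (closure \<Omega>). \<forall>v\<in>C_on (closure \<Omega>). \<forall>a b.
        E (\<lambda>x\<in>closure \<Omega>. a * u x + b * v x) = (\<lambda>x. a * E u x + b * E v x)) \<and>
     (\<forall>u\<in>C_on (closure \<Omega>). (\<forall>x\<in>closure \<Omega>. 0 \<le> u x) \<longrightarrow> (\<forall>x. 0 \<le> E u x)) \<and>
     (\<forall>u\<in>C_on (closure \<Omega>). sup_norm UNIV (E u) \<le> sup_norm (closure \<Omega>) u) \<and>
     (\<forall>u\<in>C_on (closure \<Omega>). restriction_op \<Omega> (E u) = u)"
proof -
  obtain V where V: "open V"
    and diffeo: "smooth_diffeomorphism (frontier \<Omega> \<times> {-\<delta><..<\<delta>}) V (normal_map \<nu>)"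
    using assms(9) by blast
  interpret collar_extension \<Omega> \<nu> \<delta> V \<beta> \<rho>1
  proof
    show "\<exists>\<epsilon>>0. \<forall>t\<in>{0<..<\<epsilon>}. p + t *\<^sub>R \<nu> p \<notin> closure \<Omega> \<and> p - t *\<^sub>R \<nu> p \<in> \<Omega>"
      if "p \<in> frontier \<Omega>" for p
      using assms(7) that unfolding outward_unit_normal_def by blast
  qed (use assms V diffeo in
      \<open>auto simp: smooth_diffeomorphism_def intro: smooth_on_imp_continuous_on\<close>)
  show ?thesis
    unfolding E_def
    by (intro conjI ballI allI impI Pi_I extension_in_C0 extension_linear extension_contractive
        restriction_extension) (auto simp: C_on_def inner_normal_in extension_nonneg)
qed

end
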